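(* Let $p\ge5$ be a prime and write $p-1=12m+4\delta+6\varepsilon$ with $m\in\mathbb{Z}_{\ge0}$ and $\delta,\varepsilon\in\{0,1\}$. Then the four polynomials $A_{m+\delta+\varepsilon,2}(X)$, $X^{\delta}A_{m+\varepsilon,6}(X)$, $(X-1728)^{\varepsilon}A_{m+\delta,8}(X)$ and $X^{\delta}(X-1728)^{\varepsilon}A_{m+1,0}(X)$ have $p$-integral coefficients and are pairwise congruent modulo $p$: \[ A_{m +\delta +\varepsilon,2}(X) \equiv X^{\delta} A_{m+\varepsilon,6}(X) \equiv (X -1728)^{\varepsilon} A_{m +\delta,8}(X) \equiv X^{\delta} (X -1728)^{\varepsilon} A_{m+1,0}(X) \pmod{p}. \]
   Context: Define rational functions $a_0(x)=\frac{24(144x^2-41)}{(2x+1)(2x-1)}$, $b_0(x)=\frac{36(12x-11)(12x-7)(12x-5)(12x-1)}{x(x-1)(2x-1)^2}$, $a_2(x)=\frac{24(144x^2-29)}{(2x+1)(2x-1)}$, $b_2(x)=\frac{36(12x-13)(12x-7)(12x-5)(12x+1)}{x(x-1)(2x-1)^2}$, and set $a_{n,0}=a_0(n)$, $b_{n,0}=b_0(n)$, $a_{n,2}=a_2(n)$, $b_{n,2}=b_2(n)$, $a_{n,6}=a_0(n+\tfrac12)$, $b_{n,6}=b_0(n+\tfrac12)$, $a_{n,8}=a_2(n+\tfrac12)$, $b_{n,8}=b_2(n+\tfrac12)$. The Atkin-like polynomials $A_{n,r}(X)\in\mathbb{Q}[X]$ ($r\in\{0,2,6,8\}$, $n\ge0$)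 are determined by $A_{n+1,r}=(X-a_{n,r})A_{n,r}-b_{n,r}A_{n-1,r}$, valid for $n\ge2$ when $r\in\{0,2\}$ and $n\ge1$ when $r\in\{6,8\}$, with initial values $A_{0,0}=0$, $A_{1,0}=1$, $A_{2,0}=X-824$; $A_{0,2}=1$, $A_{1,2}=X-720$, $A_{2,2}=X^2-1640X+269280$; $A_{0,6}=1$, $A_{1,6}=X-1266$; $A_{0,8}=1$, $A_{1,8}=X-330$. ($A_{n,2}$ is Atkin's orthogonal polynomial.) *)

theory Defs
  imports "HOL-Computational_Algebra.Computational_Algebra"
begin

text \<open>The rational functions are represented by their values on the rationals. Their poles are
  never met: below, they are only evaluated at integers \<open>n \<ge> 2\<close> and at \<open>n + 1/2\<close> with \<open>n \<ge> 1\<close>.\<close>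

definition a0 :: "rat \<Rightarrow> rat" where
  "a0 x = 24 * (144 * x^2 - 41) / ((2*x + 1) * (2*x - 1))"

definition b0 :: "rat \<Rightarrow> rat" where
  "b0 x = 36 * (12*x - 11) * (12*x - 7) * (12*x - 5) * (12*x - 1)
            / (x * (x - 1) * (2*x - 1)^2)"

definition a2 :: "rat \<Rightarrow> rat" where
  "a2 x = 24 * (144 * x^2 - 29) / ((2*x + 1) * (2*x - 1))"

definition b2 :: "rat \<Rightarrow> rat" where
  "b2 x = 36 * (12*x - 13) * (12*x - 7) * (12*x - 5) * (12*x + 1)
            / (x * (x - 1) * (2*x - 1)^2)"

definition a_0 :: "nat \<Rightarrow> rat" where "a_0 n = a0 (of_nat n)"
definition b_0 :: "nat \<Rightarrow> rat" where "b_0 n = b0 (of_nat n)"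
definition a_2 :: "nat \<Rightarrow> rat" where "a_2 n = a2 (of_nat n)"
definition b_2 :: "nat \<Rightarrow> rat" where "b_2 n = b2 (of_nat n)"
definition a_6 :: "nat \<Rightarrow> rat" where "a_6 n = a0 (of_nat n + 1/2)"
definition b_6 :: "nat \<Rightarrow> rat" where "b_6 n = b0 (of_nat n + 1/2)"
definition a_8 :: "nat \<Rightarrow> rat" where "a_8 n = a2 (of_nat n + 1/2)"
definition b_8 :: "nat \<Rightarrow> rat" where "b_8 n = b2 (of_nat n + 1/2)"

abbreviation X :: "rat poly" where "X \<equiv> [:0, 1:]"

text \<open>\<open>A_r n\<close> is the Atkin-like polynomial \<open>A\<^bsub>n,r\<^esub>\<close>. The last equation of each definition is
  the recurrence \<open>A\<^bsub>k+1,r\<^esub> = (X - a\<^bsub>k,r\<^esub>) A\<^bsub>k,r\<^esub> - b\<^bsub>k,r\<^esub> A\<^bsub>k-1,r\<^esub>\<close>, with \<open>k = n + 2\<close> for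
  \<open>r = 0, 2\<close> and \<open>k = n + 1\<close> for \<open>r = 6, 8\<close>.\<close>

fun A_0 :: "nat \<Rightarrow> rat poly" where
  "A_0 0 = 0"
| "A_0 (Suc 0) = 1"
| "A_0 (Suc (Suc 0)) = X - [:824:]"
| "A_0 (Suc (Suc (Suc n))) =
     (X - [:a_0 (n + 2):]) * A_0 (Suc (Suc n)) - smult (b_0 (n + 2)) (A_0 (Suc n))"

fun A_2 :: "nat \<Rightarrow> rat poly" where
  "A_2 0 = 1"
| "A_2 (Suc 0) = X - [:720:]"
| "A_2 (Suc (Suc 0)) = X^2 - smult 1640 X + [:269280:]"
| "A_2 (Suc (Suc (Suc n))) =
     (X - [:a_2 (n + 2):]) * A_2 (Suc (Suc n)) - smult (b_2 (n + 2)) (A_2 (Suc n))"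

fun A_6 :: "nat \<Rightarrow> rat poly" where
  "A_6 0 = 1"
| "A_6 (Suc 0) = X - [:1266:]"
| "A_6 (Suc (Suc n)) =
     (X - [:a_6 (n + 1):]) * A_6 (Suc n) - smult (b_6 (n + 1)) (A_6 n)"

fun A_8 :: "nat \<Rightarrow> rat poly" where
  "A_8 0 = 1"
| "A_8 (Suc 0) = X - [:330:]"
| "A_8 (Suc (Suc n)) =
     (X - [:a_8 (n + 1):]) * A_8 (Suc n) - smult (b_8 (n + 1)) (A_8 n)"

text \<open>\<open>quotient_of\<close> yields the representation in lowest terms.\<close>

definition p_integral :: "nat \<Rightarrow> rat \<Rightarrow> bool" where
  "p_integral p c \<longleftrightarrow> \<not> int p dvd snd (quotient_of c)"

definition p_integral_poly :: "nat \<Rightarrow> rat poly \<Rightarrow> bool" where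
  "p_integral_poly p F \<longleftrightarrow> (\<forall>i. p_integral p (coeff F i))"

text \<open>Congruence modulo \<open>p\<close> is taken in the ring of polynomials with \<open>p\<close>-integral coefficients:
  the difference lies in the ideal generated by \<open>p\<close>.\<close>

definition poly_cong_mod :: "nat \<Rightarrow> rat poly \<Rightarrow> rat poly \<Rightarrow> bool" where
  "poly_cong_mod p F G \<longleftrightarrow> (\<exists>H. p_integral_poly p H \<and> F - G = smult (of_nat p) H)"

end

theory Submission
  imports Defs
begin

text \<open>The families \<open>A\<^bsub>n,2\<^esub>\<close>, \<open>A\<^bsub>n,6\<^esub>\<close> are the even and odd denominators of one and the same
  S-fraction, i.e. they interlace through two-term relations
  \<open>P\<^bsub>n+1\<^esub> = L Q\<^bsub>n\<^esub> - u\<^bsub>n\<^esub> P\<^bsub>n\<^esub>\<close> and \<open>Q\<^bsub>n+1\<^esub> = P\<^bsub>n+1\<^esub> - v\<^bsub>n\<^esub> Q\<^bsub>n\<^esub>\<close> with \<open>L = X\<close>; the same holds with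
  \<open>L = X - 1728\<close> for \<open>A\<^bsub>n,2\<^esub>\<close>, \<open>A\<^bsub>n,8\<^esub>\<close> and for \<open>A\<^bsub>n,6\<^esub>\<close>, \<open>A\<^bsub>n+1,0\<^esub>\<close>. The coefficients \<open>u\<close>, \<open>v\<close> are
  quotients of products of linear factors in \<open>n\<close>. At the indices of the theorem one factor of the
  numerator equals \<open>p\<close> while all denominators met so far are prime to \<open>p\<close>, so that the two-term
  relations degenerate to the claimed congruences.\<close>

section \<open>Arithmetic of p-integral rationals and polynomials\<close>

text \<open>Allows any fraction with denominator prime to \<open>p\<close> as a witness, reduced or
  not. If \<open>p\<close> divided the reduced denominator \<open>b'\<close>, then
  \<open>a' * b = a * b'\<close> would force \<open>p\<close> to divide \<open>a'\<close> as well,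
  against coprimality.\<close>

lemma p_integral_iff:
  assumes "prime p"
  shows "p_integral p c \<longleftrightarrow> (\<exists>a b. \<not> int p dvd b \<and> c = of_int a / of_int b)"
proof
  assume "p_integral p c"
  then show "\<exists>a b. \<not> int p dvd b \<and> c = of_int a / of_int b"
    unfolding p_integral_def by (metis prod.collapse quotient_of_div)
next
  assume "\<exists>a b. \<not> int p dvd b \<and> c = of_int a / of_int b"
  then obtain a b where ab: "\<not> int p dvd b" "c = of_int a / of_int b" by blast
  obtain a' b' where q: "quotient_of c = (a', b')" by fastforce
  have c: "c = of_int a' / of_int b'" and "b' > 0" and "coprime a' b'"
    using q quotient_of_div quotient_of_denom_pos quotient_of_coprime by blast+
  have "b \<noteq> 0" using ab(1) by auto
  then have "of_int (a' * b) = (of_int (a * b') :: rat)"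
    using ab(2) c \<open>b' > 0\<close> by (simp add: field_simps)
  then have eq: "a' * b = a * b'" by (simp only: of_int_eq_iff)
  have "\<not> int p dvd b'"
  proof
    assume d: "int p dvd b'"
    then have "int p dvd a' * b" using eq by simp
    then have "int p dvd a'"
      using ab(1) assms by (meson prime_dvd_mult_iff prime_nat_int_transfer)
    with d \<open>coprime a' b'\<close> have "is_unit (int p)" by (meson coprime_common_divisor)
    with assms show False by (simp add: prime_nat_iff)
  qed
  then show "p_integral p c" by (simp add: p_integral_def q)
qed

lemma p_integral_divide:
  assumes "prime p" "\<not> int p dvd b"
  shows "p_integral p (of_int a / of_int b)"
  using assms p_integral_iff by blast

lemma p_integral_of_int:
  assumes "prime p"
  shows "p_integral p (of_int a)"
  using p_integral_divide[OF assms, of 1 a] assms by (simp add: prime_nat_iff)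

lemma p_integral_add:
  assumes "prime p" "p_integral p x" "p_integral p y"
  shows "p_integral p (x + y)"
proof -
  obtain a b c d where *: "\<not> int p dvd b" "x = of_int a / of_int b"
      "\<not> int p dvd d" "y = of_int c / of_int d"
    using assms p_integral_iff by metis
  then have "b \<noteq> 0" "d \<noteq> 0" by auto
  then have "x + y = of_int (a * d + c * b) / of_int (b * d)"
    using * by (simp add: field_simps)
  moreover have "\<not> int p dvd b * d"
    using * assms(1) by (simp add: prime_dvd_mult_iff)
  ultimately show ?thesis using p_integral_divide[OF assms(1)] by metis
qed

lemma p_integral_mult:
  assumes "prime p" "p_integral p x" "p_integral p y"
  shows "p_integral p (x * y)"
proof -
  obtain a b c d where *: "\<not> int p dvd b" "x = of_int a / of_int b"
      "\<not> int p dvd d" "y = of_int c / of_int d"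
    using assms p_integral_iff by metis
  then have "x * y = of_int (a * c) / of_int (b * d)" by simp
  moreover have "\<not> int p dvd b * d"
    using * assms(1) by (simp add: prime_dvd_mult_iff)
  ultimately show ?thesis using p_integral_divide[OF assms(1)] by metis
qed

lemma p_integral_sum:
  assumes "prime p" "\<And>i. i \<in> I \<Longrightarrow> p_integral p (f i)"
  shows "p_integral p (sum f I)"
  using assms(2) p_integral_of_int[OF assms(1), of 0]
  by (induction I rule: infinite_finite_induct) (auto intro: p_integral_add[OF assms(1)])

lemma p_integral_poly_add:
  assumes "prime p" "p_integral_poly p F" "p_integral_poly p G"
  shows "p_integral_poly p (F + G)"
  using assms by (simp add: p_integral_poly_def p_integral_add)

lemma p_integral_poly_mult:
  assumes "prime p" "p_integral_poly p F" "p_integral_poly p G"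
  shows "p_integral_poly p (F * G)"
  using assms by (simp add: p_integral_poly_def coeff_mult p_integral_sum p_integral_mult)

lemma p_integral_poly_smult:
  assumes "prime p" "p_integral p c" "p_integral_poly p F"
  shows "p_integral_poly p (smult c F)"
  using assms by (simp add: p_integral_poly_def p_integral_mult)

lemma p_integral_poly_minus:
  assumes "prime p" "p_integral_poly p F"
  shows "p_integral_poly p (- F)"
  using p_integral_poly_smult[OF assms(1) p_integral_of_int[OF assms(1), of "-1"] assms(2)]
  by simp

lemma p_integral_poly_diff:
  assumes "prime p" "p_integral_poly p F" "p_integral_poly p G"
  shows "p_integral_poly p (F - G)"
  using p_integral_poly_add[OF assms(1,2) p_integral_poly_minus[OF assms(1,3)]] by simp

lemma p_integral_poly_0: "prime p \<Longrightarrow> p_integral_poly p 0"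
  using p_integral_of_int[of p 0] by (simp add: p_integral_poly_def)

lemma p_integral_poly_1: "prime p \<Longrightarrow> p_integral_poly p 1"
  using p_integral_of_int[of p 0] p_integral_of_int[of p 1]
  by (simp add: p_integral_poly_def coeff_1)

lemma p_integral_poly_linear:
  assumes "prime p"
  shows "p_integral_poly p (X - [:of_int c:])"
  using p_integral_of_int[OF assms, of "-c"] p_integral_of_int[OF assms, of 0]
    p_integral_of_int[OF assms, of 1]
  by (auto simp: p_integral_poly_def coeff_pCons split: nat.split)

section \<open>Congruence modulo \<open>p\<close>\<close>

lemma poly_cong_mod_refl: "prime p \<Longrightarrow> poly_cong_mod p F F"
  unfolding poly_cong_mod_def using p_integral_poly_0 by force

lemma poly_cong_mod_sym:
  assumes "prime p" "poly_cong_mod p F G"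
  shows "poly_cong_mod p G F"
  using assms p_integral_poly_minus unfolding poly_cong_mod_def
  by (metis minus_diff_eq smult_minus_right)

lemma poly_cong_mod_trans:
  assumes "prime p" "poly_cong_mod p F G" "poly_cong_mod p G H"
  shows "poly_cong_mod p F H"
proof -
  obtain U V where "p_integral_poly p U" "F - G = smult (of_nat p) U"
      "p_integral_poly p V" "G - H = smult (of_nat p) V"
    using assms unfolding poly_cong_mod_def by blast
  then have "p_integral_poly p (U + V)" "F - H = smult (of_nat p) (U + V)"
    using p_integral_poly_add[OF assms(1)] by (simp_all add: smult_add_right algebra_simps)
  then show ?thesis unfolding poly_cong_mod_def by blast
qed

lemma poly_cong_mod_mult_left:
  assumes "prime p" "p_integral_poly p H" "poly_cong_mod p F G"
  shows "poly_cong_mod p (H * F) (H * G)"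
  using assms p_integral_poly_mult unfolding poly_cong_mod_def
  by (metis mult_smult_right right_diff_distrib)

text \<open>Integrality of \<open>c / of_nat p\<close> expresses that \<open>p\<close> divides
  \<open>c\<close> among the p-integral rationals. This is how a two-term relation loses its last
  term modulo \<open>p\<close>.\<close>

lemma poly_cong_mod_diff_smult:
  assumes "prime p" "p_integral p (c / of_nat p)" "p_integral_poly p G"
  shows "poly_cong_mod p (F - smult c G) F"
proof -
  have "F - smult c G - F = smult (of_nat p) (- smult (c / of_nat p) G)"
    using assms(1) by (simp add: prime_gt_0_nat)
  then show ?thesis
    unfolding poly_cong_mod_def using assms p_integral_poly_smult p_integral_poly_minus by metis
qed

section \<open>Interlaced sequences and their three-term recurrences\<close>

definition interlaced ::
    "rat poly \<Rightarrow> (nat \<Rightarrow> rat) \<Rightarrow> (nat \<Rightarrow> rat) \<Rightarrow> (nat \<Rightarrow> rat poly) \<Rightarrow> (nat \<Rightarrow> rat poly) \<Rightarrow> bool" where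
  "interlaced L u v P Q \<longleftrightarrow> P 0 = 1 \<and> Q 0 = 1 \<and>
     (\<forall>n. P (Suc n) = L * Q n - smult (u n) (P n)) \<and>
     (\<forall>n. Q (Suc n) = P (Suc n) - smult (v n) (Q n))"

text \<open>Eliminating one family from the two-term relations gives a three-term recurrence for the
  other, with sums and products of neighbouring \<open>u\<close>, \<open>v\<close> as coefficients.
  The induction runs this backwards and carries both two-term relations at once, since each step
  uses both.\<close>

lemma interlacedI:
  fixes P Q :: "nat \<Rightarrow> rat poly"
  assumes "P 0 = 1" "Q 0 = 1"
    and P1: "P (Suc 0) = L - [:u 0:]" and Q1: "Q (Suc 0) = P (Suc 0) - [:v 0:]"
    and P: "\<And>n. P (Suc (Suc n)) =
      (L - [:v n + u (Suc n):]) * P (Suc n) - smult (u n * v n) (P n)"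
    and Q: "\<And>n. Q (Suc (Suc n)) =
      (L - [:u (Suc n) + v (Suc n):]) * Q (Suc n) - smult (v n * u (Suc n)) (Q n)"
  shows "interlaced L u v P Q"
proof -
  have "P (Suc n) = L * Q n - smult (u n) (P n) \<and>
        Q (Suc n) = P (Suc n) - smult (v n) (Q n)" for n
  proof (induction n)
    case 0
    then show ?case using assms(1-4) by (simp add: one_pCons)
  next
    case (Suc n)
    have const: "F - [:a + b:] = F - smult a 1 - smult b 1" for F and a b :: rat
      by (simp add: one_pCons)
    have LQ: "L * Q n = P (Suc n) + smult (u n) (P n)"
      and Qs: "Q (Suc n) = P (Suc n) - smult (v n) (Q n)"
      and vQ: "smult (v n) (Q n) = P (Suc n) - Q (Suc n)"
      using Suc by simp_all
    have "smult (v n) (L * Q n) = smult (v n) (P (Suc n)) + smult (u n * v n) (P n)"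
      unfolding LQ by (simp add: smult_add_right mult.commute)
    then have 1: "P (Suc (Suc n)) = L * Q (Suc n) - smult (u (Suc n)) (P (Suc n))"
      unfolding P Qs const by (simp add: algebra_simps smult_add_left)
    have "smult (v n * u (Suc n)) (Q n) = smult (u (Suc n)) (smult (v n) (Q n))"
      by (simp add: mult.commute)
    then have "Q (Suc (Suc n)) = P (Suc (Suc n)) - smult (v (Suc n)) (Q (Suc n))"
      unfolding Q 1 const vQ by (simp add: algebra_simps smult_diff_right smult_add_left)
    with 1 show ?case by blast
  qed
  then show ?thesis using assms(1,2) by (simp add: interlaced_def)
qed

text \<open>Only coefficients with index below \<open>n\<close> enter \<open>P n\<close> and
  \<open>Q n\<close>. The bound matters: later coefficients may have \<open>p\<close> in the
  denominator.\<close>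

lemma interlaced_integral:
  assumes "interlaced L u v P Q" "prime p" "p_integral_poly p L"
    and "\<And>i. i < n \<Longrightarrow> p_integral p (u i)" "\<And>i. i < n \<Longrightarrow> p_integral p (v i)"
  shows "p_integral_poly p (P n) \<and> p_integral_poly p (Q n)"
  using assms(4,5)
proof (induction n)
  case 0
  then show ?case using assms(1,2) p_integral_poly_1 by (simp add: interlaced_def)
next
  case (Suc n)
  then have "p_integral_poly p (P n)" "p_integral_poly p (Q n)" by auto
  then have "p_integral_poly p (P (Suc n))"
    using assms(1-3) Suc.prems
    by (simp add: interlaced_def p_integral_poly_diff p_integral_poly_mult p_integral_poly_smult)
  then show ?case
    using assms(1-3) Suc.prems \<open>p_integral_poly p (Q n)\<close>
    by (auto simp: interlaced_def intro!: p_integral_poly_diff p_integral_poly_smult)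
qed

lemma interlaced_cong_mod:
  assumes "interlaced L u v P Q" "prime p"
  shows "p_integral p (u n / of_nat p) \<Longrightarrow> p_integral_poly p (P n) \<Longrightarrow>
           poly_cong_mod p (P (Suc n)) (L * Q n)"
    and "p_integral p (v n / of_nat p) \<Longrightarrow> p_integral_poly p (Q n) \<Longrightarrow>
           poly_cong_mod p (Q (Suc n)) (P (Suc n))"
  using assms poly_cong_mod_diff_smult by (auto simp: interlaced_def)

section \<open>The coefficients of the three interlacings\<close>

text \<open>\<open>u26 n\<close> and \<open>v26 n\<close> are the \<open>\<lambda>\<^bsub>2n+1\<^esub>\<close> and \<open>\<lambda>\<^bsub>2n+2\<^esub>\<close> of Kaneko and Zagier, where
  \<open>\<lambda>\<^bsub>k\<^esub> = 12 (6 + (-1)\<^sup>k / (k - 1)) (6 + (-1)\<^sup>k / k)\<close> for \<open>k > 1\<close> and \<open>\<lambda>\<^bsub>1\<^esub> = 720\<close>.\<close>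

definition u26 :: "nat \<Rightarrow> rat" where
  "u26 n = (if n = 0 then 720
     else of_int (6 * (12 * int n - 1) * (12 * int n + 5)) / of_int (int n * (2 * int n + 1)))"

definition v26 :: "nat \<Rightarrow> rat" where
  "v26 n = of_int (6 * (12 * int n + 7) * (12 * int n + 13)) / of_int ((int n + 1) * (2 * int n + 1))"

text \<open>The value at 0, where the general formula has denominator 0, comes from X - 720 = (X -
  1728) + 1008.\<close>

definition u28 :: "nat \<Rightarrow> rat" where
  "u28 n = (if n = 0 then -1008
     else of_int (-6 * (12 * int n - 1) * (12 * int n + 7)) / of_int (int n * (2 * int n + 1)))"

definition v28 :: "nat \<Rightarrow> rat" where
  "v28 n = of_int (-6 * (12 * int n + 5) * (12 * int n + 13)) / of_int ((int n + 1) * (2 * int n + 1))"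

definition u60 :: "nat \<Rightarrow> rat" where
  "u60 n = of_int (-6 * (12 * int n + 7) * (12 * int n + 11)) / of_int ((int n + 1) * (2 * int n + 1))"

definition v60 :: "nat \<Rightarrow> rat" where
  "v60 n = of_int (-6 * (12 * int n + 13) * (12 * int n + 17)) / of_int ((int n + 1) * (2 * int n + 3))"

lemma denominators_nonzero:
  "(of_nat n :: rat) + 1 \<noteq> 0" "(of_nat n :: rat) + 2 \<noteq> 0"
  "2 * (of_nat n :: rat) + 1 \<noteq> 0" "2 * (of_nat n :: rat) + 3 \<noteq> 0"
  "2 * (of_nat n :: rat) + 5 \<noteq> 0"
  using of_nat_0_le_iff[of n, where 'a = rat] by linarith+

text \<open>Brings the denominators at the shifted arguments \<open>n + 2\<close> and
  \<open>n + 1 + 1/2\<close> to the linear factors that \<open>denominators_nonzero\<close>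
  covers.\<close>

lemma denominator_shifts:
  fixes x :: rat
  shows "2 * (x + 2) + 1 = 2 * x + 5" "2 * (x + 2) - 1 = 2 * x + 3" "x + 2 - 1 = x + 1"
    "2 * (x + 1 + 1/2) + 1 = 2 * (x + 2)" "2 * (x + 1 + 1/2) - 1 = 2 * (x + 1)"
    "x + 1 + 1/2 = (2 * x + 3) / 2" "x + 1 + 1/2 - 1 = (2 * x + 1) / 2"
    "2 * (x + 1) + 1 = 2 * x + 3" "2 * (x + 1) + 3 = 2 * x + 5" "x + 1 + 1 = x + 2"
  by (simp_all add: field_simps)

text \<open>Identities between rational functions of \<open>n\<close>, checked by clearing
  denominators. \<open>u26\<close> and \<open>u28\<close> occur only at positive indices, away from
  their exceptional value at 0.\<close>

lemma three_term_coeffs: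
  "a_2 (n + 2) = v26 (n + 1) + u26 (n + 2)"
  "b_2 (n + 2) = u26 (n + 1) * v26 (n + 1)"
  "a_6 (n + 1) = u26 (n + 1) + v26 (n + 1)"
  "b_6 (n + 1) = v26 n * u26 (n + 1)"
  "a_2 (n + 2) = 1728 + v28 (n + 1) + u28 (n + 2)"
  "b_2 (n + 2) = u28 (n + 1) * v28 (n + 1)"
  "a_8 (n + 1) = 1728 + u28 (n + 1) + v28 (n + 1)"
  "b_8 (n + 1) = v28 n * u28 (n + 1)"
  "a_6 (n + 1) = 1728 + v60 n + u60 (n + 1)"
  "b_6 (n + 1) = u60 n * v60 n"
  "a_0 (n + 2) = 1728 + u60 (n + 1) + v60 (n + 1)"
  "b_0 (n + 2) = v60 n * u60 (n + 1)"
  using denominators_nonzero[of n]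
  unfolding a_0_def b_0_def a_2_def b_2_def a_6_def b_6_def a_8_def b_8_def a0_def b0_def
    a2_def b2_def u26_def v26_def u28_def v28_def u60_def v60_def
  by (simp_all add: denominator_shifts, simp_all add: divide_simps,
      simp_all add: algebra_simps power2_eq_square)

lemma interlaced_26: "interlaced X u26 v26 A_2 A_6"
proof (rule interlacedI)
  show "A_2 (Suc (Suc n)) =
      (X - [:v26 n + u26 (Suc n):]) * A_2 (Suc n) - smult (u26 n * v26 n) (A_2 n)" for n
  proof (cases n)
    \<comment> \<open>\<open>A_2 2\<close> is an initial value, not an instance of the recurrence,
      so this case is a numerical check that involves \<open>u26 0 = 720\<close>.\<close>
    case 0
    then show ?thesis by (simp add: u26_def v26_def power2_eq_square)
  next
    case (Suc k)
    then show ?thesis using three_term_coeffs(1,2)[of k] by simp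
  qed
  show "A_6 (Suc (Suc n)) =
      (X - [:u26 (Suc n) + v26 (Suc n):]) * A_6 (Suc n) - smult (v26 n * u26 (Suc n)) (A_6 n)" for n
    using three_term_coeffs(3,4)[of n] by simp
qed (simp_all add: u26_def v26_def)

lemma diff_constants: "F - [:a:] - [:b:] = F - [:a + b:]" for a b :: rat
  by (simp add: diff_diff_eq)

lemma interlaced_28: "interlaced (X - [:1728:]) u28 v28 A_2 A_8"
proof (rule interlacedI)
  show "A_2 (Suc (Suc n)) =
      (X - [:1728:] - [:v28 n + u28 (Suc n):]) * A_2 (Suc n) - smult (u28 n * v28 n) (A_2 n)" for n
  proof (cases n)
    case 0
    then show ?thesis by (simp add: u28_def v28_def power2_eq_square)
  next
    case (Suc k)
    then show ?thesis using three_term_coeffs(5,6)[of k] by (simp add: diff_constants add.assoc del: diff_pCons)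
  qed
  show "A_8 (Suc (Suc n)) = (X - [:1728:] - [:u28 (Suc n) + v28 (Suc n):]) * A_8 (Suc n)
      - smult (v28 n * u28 (Suc n)) (A_8 n)" for n
    using three_term_coeffs(7,8)[of n] by (simp add: diff_constants add.assoc del: diff_pCons)
qed (simp_all add: u28_def v28_def)

text \<open>The index of \<open>A_0\<close> is shifted because its sequence starts with 0, while
  \<open>interlaced\<close> needs the initial value 1.\<close>

lemma interlaced_60: "interlaced (X - [:1728:]) u60 v60 A_6 (\<lambda>n. A_0 (Suc n))"
proof (rule interlacedI)
  show "A_6 (Suc (Suc n)) =
      (X - [:1728:] - [:v60 n + u60 (Suc n):]) * A_6 (Suc n) - smult (u60 n * v60 n) (A_6 n)" for n
    using three_term_coeffs(9,10)[of n] by (simp add: diff_constants add.assoc del: diff_pCons)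
  show "A_0 (Suc (Suc (Suc n))) = (X - [:1728:] - [:u60 (Suc n) + v60 (Suc n):]) * A_0 (Suc (Suc n))
      - smult (v60 n * u60 (Suc n)) (A_0 (Suc n))" for n
    using three_term_coeffs(11,12)[of n] by (simp add: diff_constants add.assoc del: diff_pCons)
qed (simp_all add: u60_def v60_def)

section \<open>Integrality of the coefficients and their divisibility by \<open>p\<close>\<close>

lemma not_dvd_mult_small:
  assumes "prime p" "0 < a" "a < int p" "0 < b" "b < int p"
  shows "\<not> int p dvd a * b"
  using assms zdvd_not_zless by (auto simp: prime_dvd_mult_iff)

lemma p_integral_divide_small:
  assumes "prime p" "0 < a" "a < int p" "0 < b" "b < int p"
  shows "p_integral p (of_int c / of_int (a * b))"
  by (intro p_integral_divide not_dvd_mult_small assms)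

lemma p_integral_divide_small_prime:
  assumes "prime p" "int p = d \<or> int p = e" "0 < a" "a < int p" "0 < b" "b < int p"
  shows "p_integral p (of_int (c * d * e) / of_int (a * b) / of_nat p)"
proof -
  obtain k where "c * d * e = int p * k" using assms(2) by (metis mult.assoc mult.commute)
  then have "(of_int (c * d * e) / of_int (a * b) / of_nat p :: rat) = of_int k / of_int (a * b)"
    using assms(1) by (simp add: prime_gt_0_nat del: of_int_mult) (simp add: prime_gt_0_nat)
  then show ?thesis using p_integral_divide_small[OF assms(1,3-6)] by simp
qed

lemma p_integral_coeffs:
  assumes "prime p"
  shows "2 * n + 1 < p \<Longrightarrow> p_integral p (u26 n)" "2 * n + 1 < p \<Longrightarrow> p_integral p (v26 n)"
    "2 * n + 1 < p \<Longrightarrow> p_integral p (u28 n)" "2 * n + 1 < p \<Longrightarrow> p_integral p (v28 n)"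
    "2 * n + 1 < p \<Longrightarrow> p_integral p (u60 n)" "2 * n + 3 < p \<Longrightarrow> p_integral p (v60 n)"
  using p_integral_of_int[OF assms, of 720] p_integral_of_int[OF assms, of "-1008"]
  unfolding u26_def v26_def u28_def v28_def u60_def v60_def
  by (auto intro!: p_integral_divide_small[OF assms] simp del: of_int_mult)

text \<open>Each alternative says that \<open>p\<close> equals one linear factor of the numerator;
  \<open>p + 1 = 12 * n\<close> stands for the factor 12n - 1. All factors of the denominator are
  positive and below \<open>p\<close>.\<close>

lemma p_integral_coeffs_div_p:
  assumes "prime p" "2 * n + 1 < p"
  shows "p = 12 * n + 5 \<or> n > 0 \<and> p + 1 = 12 * n \<Longrightarrow> p_integral p (u26 n / of_nat p)"
    "p = 12 * n + 7 \<or> p = 12 * n + 13 \<Longrightarrow> p_integral p (v26 n / of_nat p)"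
    "p = 12 * n + 7 \<or> n > 0 \<and> p + 1 = 12 * n \<Longrightarrow> p_integral p (u28 n / of_nat p)"
    "p = 12 * n + 5 \<or> p = 12 * n + 13 \<Longrightarrow> p_integral p (v28 n / of_nat p)"
    "p = 12 * n + 7 \<or> p = 12 * n + 11 \<Longrightarrow> p_integral p (u60 n / of_nat p)"
    "p = 12 * n + 13 \<or> p = 12 * n + 17 \<Longrightarrow> p_integral p (v60 n / of_nat p)"
proof -
  note divide = p_integral_divide_small_prime[OF assms(1)]
  show "p_integral p (u26 n / of_nat p)" if *: "p = 12 * n + 5 \<or> n > 0 \<and> p + 1 = 12 * n"
  proof (cases "n = 0")
    case True
    \<comment> \<open>The exceptional value is 720 = 5 * 144; likewise -1008 = 7 * (-144) for
      \<open>u28\<close> below.\<close>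
    then have "p = 5" using * by simp
    then show ?thesis
      using True p_integral_of_int[OF assms(1), of 144] by (simp add: u26_def)
  next
    case False
    then show ?thesis
      unfolding u26_def if_not_P[OF False] using * assms(2) by (intro divide) auto
  qed
  show "p_integral p (u28 n / of_nat p)" if *: "p = 12 * n + 7 \<or> n > 0 \<and> p + 1 = 12 * n"
  proof (cases "n = 0")
    case True
    then have "p = 7" using * by simp
    then show ?thesis
      using True p_integral_of_int[OF assms(1), of "-144"] by (simp add: u28_def)
  next
    case False
    then show ?thesis
      unfolding u28_def if_not_P[OF False] using * assms(2) by (intro divide) auto
  qed
  show "p_integral p (v26 n / of_nat p)" if "p = 12 * n + 7 \<or> p = 12 * n + 13"
    unfolding v26_def using that assms(2) by (intro divide) auto
  show "p_integral p (v28 n / of_nat p)" if "p = 12 * n + 5 \<or> p = 12 * n + 13"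
    unfolding v28_def using that assms(2) by (intro divide) auto
  show "p_integral p (u60 n / of_nat p)" if "p = 12 * n + 7 \<or> p = 12 * n + 11"
    unfolding u60_def using that assms(2) by (intro divide) auto
  show "p_integral p (v60 n / of_nat p)" if "p = 12 * n + 13 \<or> p = 12 * n + 17"
    unfolding v60_def using that assms(2) by (intro divide) auto
qed

section \<open>The congruences at the indices attached to \<open>p\<close>\<close>

theorem theorem2p6:
  fixes p m \<delta> \<epsilon> :: nat
  assumes "prime p" and "p \<ge> 5"
    and "\<delta> \<in> {0, 1}" and "\<epsilon> \<in> {0, 1}"
    and "p - 1 = 12 * m + 4 * \<delta> + 6 * \<epsilon>"
  shows "let S = {A_2 (m + \<delta> + \<epsilon>),
                  X ^ \<delta> * A_6 (m + \<epsilon>),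
                  (X - [:1728:]) ^ \<epsilon> * A_8 (m + \<delta>),
                  X ^ \<delta> * (X - [:1728:]) ^ \<epsilon> * A_0 (m + 1)}
         in (\<forall>F \<in> S. p_integral_poly p F) \<and>
            (\<forall>F \<in> S. \<forall>G \<in> S. poly_cong_mod p F G)"
proof -
  note p = \<open>prime p\<close>
  have p_eq: "p = 12 * m + 4 * \<delta> + 6 * \<epsilon> + 1" using assms(2,5) by simp
  have LX: "p_integral_poly p X" and L1728: "p_integral_poly p (X - [:1728:])"
    using p_integral_poly_linear[OF p, of 0] p_integral_poly_linear[OF p, of 1728] by simp_all
  have int26: "p_integral_poly p (A_2 n) \<and> p_integral_poly p (A_6 n)" if "2 * n < p + 1" for n
    using that by (intro interlaced_integral[OF interlaced_26 p LX] p_integral_coeffs[OF p]) auto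
  have int8: "p_integral_poly p (A_8 n)" if "2 * n < p + 1" for n
    using interlaced_integral[OF interlaced_28 p L1728, of n] p_integral_coeffs[OF p] that by auto
  have int0: "p_integral_poly p (A_0 (Suc n))" if "2 * n + 1 < p" for n
    using interlaced_integral[OF interlaced_60 p L1728, of n] p_integral_coeffs[OF p] that by auto
  \<comment> \<open>\<open>?F0\<close> is bracketed so that its right factor can be compared with
    \<open>A_6 (m + \<epsilon>)\<close> before multiplying by \<open>X ^ \<delta>\<close>.\<close>
  let ?F2 = "A_2 (m + \<delta> + \<epsilon>)" and ?F6 = "X ^ \<delta> * A_6 (m + \<epsilon>)"
    and ?F8 = "(X - [:1728:]) ^ \<epsilon> * A_8 (m + \<delta>)"
    and ?F0 = "X ^ \<delta> * ((X - [:1728:]) ^ \<epsilon> * A_0 (m + 1))"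
  have pow: "p_integral_poly p (X ^ \<delta>)" "p_integral_poly p ((X - [:1728:]) ^ \<epsilon>)"
    using assms(3,4) LX L1728 p_integral_poly_1[OF p] by auto
  have "2 * m + 1 < p" using p_eq assms(2) by linarith
  then have "p_integral_poly p (A_6 (m + \<epsilon>))" "p_integral_poly p (A_8 (m + \<delta>))"
      "p_integral_poly p (A_0 (m + 1))"
    using int26[of "m + \<epsilon>"] int8[of "m + \<delta>"] int0[of m] p_eq by auto
  then have ints: "p_integral_poly p ?F6" "p_integral_poly p ?F8" "p_integral_poly p ?F0"
    by (blast intro: p_integral_poly_mult[OF p] pow)+
  have int_F2: "p_integral_poly p ?F2" using int26[of "m + \<delta> + \<epsilon>"] p_eq by simp
  have c26: "poly_cong_mod p ?F6 ?F2"
  proof (cases "\<delta> = 0")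
    case True
    then obtain n where n: "m + \<epsilon> = Suc n" using p_eq assms(2) by (cases "m + \<epsilon>") auto
    \<comment> \<open>\<open>p\<close> is 12n + 13 for \<epsilon> = 0 and 12n + 7 for \<epsilon> =
      1, a factor of the numerator of \<open>v26 n\<close> either way.\<close>
    have "poly_cong_mod p (A_6 (Suc n)) (A_2 (Suc n))"
      using n p_eq assms(4) True int26[of n]
      by (intro interlaced_cong_mod(2)[OF interlaced_26 p] p_integral_coeffs_div_p[OF p]) auto
    then show ?thesis using n True by simp
  next
    case False
    then have "\<delta> = 1" using assms(3) by simp
    \<comment> \<open>With n = m + \<epsilon>, \<open>p\<close> is 12n + 5 or 12n - 1, the two
      factors in \<open>u26 n\<close>.\<close>
    have "poly_cong_mod p (A_2 (Suc (m + \<epsilon>))) (X * A_6 (m + \<epsilon>))"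
      using p_eq assms(4) \<open>\<delta> = 1\<close> int26[of "m + \<epsilon>"]
      by (intro interlaced_cong_mod(1)[OF interlaced_26 p] p_integral_coeffs_div_p[OF p]) auto
    then show ?thesis using \<open>\<delta> = 1\<close> poly_cong_mod_sym[OF p] by simp
  qed
  have c28: "poly_cong_mod p ?F8 ?F2"
  proof (cases "\<epsilon> = 0")
    case True
    then obtain n where n: "m + \<delta> = Suc n" using p_eq assms(2) by (cases "m + \<delta>") auto
    \<comment> \<open>\<open>p\<close> is 12n + 13 for \<delta> = 0 and 12n + 5 for \<delta> = 1, as
      in \<open>v28 n\<close>.\<close>
    have "poly_cong_mod p (A_8 (Suc n)) (A_2 (Suc n))"
      using n p_eq assms(3) True int8[of n]
      by (intro interlaced_cong_mod(2)[OF interlaced_28 p] p_integral_coeffs_div_p[OF p]) auto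
    then show ?thesis using n True by simp
  next
    case False
    then have "\<epsilon> = 1" using assms(4) by simp
    \<comment> \<open>With n = m + \<delta>, \<open>p\<close> is 12n + 7 or 12n - 1, as in
      \<open>u28 n\<close>.\<close>
    have "poly_cong_mod p (A_2 (Suc (m + \<delta>))) ((X - [:1728:]) * A_8 (m + \<delta>))"
      using p_eq assms(3) \<open>\<epsilon> = 1\<close> int26[of "m + \<delta>"]
      by (intro interlaced_cong_mod(1)[OF interlaced_28 p] p_integral_coeffs_div_p[OF p]) auto
    then show ?thesis using \<open>\<epsilon> = 1\<close> poly_cong_mod_sym[OF p] by simp
  qed
  have "poly_cong_mod p ((X - [:1728:]) ^ \<epsilon> * A_0 (m + 1)) (A_6 (m + \<epsilon>))"
  proof (cases "\<epsilon> = 0")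
    case True
    show ?thesis
    proof (cases m)
      \<comment> \<open>Both sides are 1 here.\<close>
      case 0
      then show ?thesis using True poly_cong_mod_refl[OF p] by simp
    next
      case (Suc n)
      \<comment> \<open>\<open>p\<close> is 12n + 13 for \<delta> = 0 and 12n + 17 for \<delta> = 1,
        as in \<open>v60 n\<close>.\<close>
      have "poly_cong_mod p (A_0 (Suc (Suc n))) (A_6 (Suc n))"
        using Suc p_eq assms(3) True int0[of n]
        by (intro interlaced_cong_mod(2)[OF interlaced_60 p] p_integral_coeffs_div_p[OF p]) auto
      then show ?thesis using Suc True by simp
    qed
  next
    case False
    then have "\<epsilon> = 1" using assms(4) by simp
    \<comment> \<open>\<open>p\<close> is 12m + 7 or 12m + 11, as in \<open>u60 m\<close>.\<close>
    have "poly_cong_mod p (A_6 (Suc m)) ((X - [:1728:]) * A_0 (Suc m))"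
      using p_eq assms(3) \<open>\<epsilon> = 1\<close> int26[of m]
      by (intro interlaced_cong_mod(1)[OF interlaced_60 p] p_integral_coeffs_div_p[OF p]) auto
    then show ?thesis using \<open>\<epsilon> = 1\<close> poly_cong_mod_sym[OF p] by simp
  qed
  then have "poly_cong_mod p ?F0 ?F6"
    by (rule poly_cong_mod_mult_left[OF p pow(1)])
  then have c20: "poly_cong_mod p ?F0 ?F2" using c26 poly_cong_mod_trans[OF p] by blast
  define S where "S = {?F2, ?F6, ?F8, ?F0}"
  have "\<forall>F\<in>S. p_integral_poly p F" using int_F2 ints by (simp add: S_def)
  moreover have "\<forall>F\<in>S. poly_cong_mod p F ?F2"
    using c26 c28 c20 poly_cong_mod_refl[OF p] by (simp add: S_def)
  then have "\<forall>F\<in>S. \<forall>G\<in>S. poly_cong_mod p F G"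
    using poly_cong_mod_trans[OF p] poly_cong_mod_sym[OF p] by meson
  ultimately show ?thesis by (simp add: S_def Let_def mult.assoc)
qed

end
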